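(* There exists an ordering of the edges of the Pascal diagram into $0,1$ such that both the set $X_{\min}$ of infinite minimal paths and the set $X_{\max}$ of infinite maximal paths have the cardinality of the continuum.
   Context: The Pascal diagram is the infinite graded graph with vertex set $\mathbb Z_+\times\mathbb Z_+$ (where $\mathbb Z_+=\{0,1,2,\dots\}$), levels $V_n=\{(i,j): i+j=n\}$, and, from each vertex $(i,j)$, exactly one edge to $(i+1,j)$ and exactly one edge to $(i,j+1)$; edges are directed from level $V_n$ to level $V_{n+1}$. Infinite paths are sequences of connected edges $(e_0,e_1,\dots)$ starting at $(0,0)$ with $e_n$ joining $V_n$ to $V_{n+1}$. An ordering of the edges (into $0,1$) is a choice, for every vertex $v\neq(0,0)$, of a linear order on the set $r^{-1}(v)$ of edges arriving at $v$: if $v=(i,j)$ with $i,j\ge 1$, one of its two incoming edges is labeled $0$ (minimal) and the other is labeled $1$ (maximal); if $v$ has a single incoming edge ($i=0$ or $j=0$), that edge is both minimal and maximal. An infinite path is minimal (respectively maximal) if each of its edges $e$ is minimal (respectively maximal) in $r^{-1}(r(e))$, where $r(e)$ is the endpoint of $e$ on the higher-indexed level. *)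

theory Defs
  imports Complex_Main "HOL-Library.Equipollence"
begin

type_synonym vertex = "nat \<times> nat"

(* The diagram has no multiple edges, so an edge is the pair (source, range) of its endpoints. *)
type_synonym edge = "vertex \<times> vertex"

definition pascal_edges :: "edge set" where
  "pascal_edges = {((i, j), (Suc i, j)) | i j. True} \<union> {((i, j), (i, Suc j)) | i j. True}"

definition level :: "nat \<Rightarrow> vertex set" where
  "level n = {(i, j). i + j = n}"

(* The set r^{-1}(v). *)
definition incoming :: "vertex \<Rightarrow> edge set" where
  "incoming v = {e \<in> pascal_edges. snd e = v}"

(* The value R (0, 0) is irrelevant. At (i, j) with i, j >= 1 the set of incoming edges has two
   elements, so a linear order on it is the same thing as a labelling of one of them by 0
   (the minimal one) and of the other by 1 (the maximal one). *)
definition edge_ordering :: "(vertex \<Rightarrow> edge rel) \<Rightarrow> bool" where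
  "edge_ordering R \<longleftrightarrow> (\<forall>v. v \<noteq> (0, 0) \<longrightarrow> linear_order_on (incoming v) (R v))"

definition minimal_edge :: "(vertex \<Rightarrow> edge rel) \<Rightarrow> edge \<Rightarrow> bool" where
  "minimal_edge R e \<longleftrightarrow>
     e \<in> pascal_edges \<and> (\<forall>e' \<in> incoming (snd e). (e, e') \<in> R (snd e))"

definition maximal_edge :: "(vertex \<Rightarrow> edge rel) \<Rightarrow> edge \<Rightarrow> bool" where
  "maximal_edge R e \<longleftrightarrow>
     e \<in> pascal_edges \<and> (\<forall>e' \<in> incoming (snd e). (e', e) \<in> R (snd e))"

definition infinite_paths :: "(nat \<Rightarrow> edge) set" where
  "infinite_paths = {p. fst (p 0) = (0, 0) \<and>
     (\<forall>n. p n \<in> pascal_edges \<and> fst (p n) \<in> level n \<and> snd (p n) \<in> level (Suc n) \<and>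
          snd (p n) = fst (p (Suc n)))}"

definition X_min :: "(vertex \<Rightarrow> edge rel) \<Rightarrow> (nat \<Rightarrow> edge) set" where
  "X_min R = {p \<in> infinite_paths. \<forall>n. minimal_edge R (p n)}"

definition X_max :: "(vertex \<Rightarrow> edge rel) \<Rightarrow> (nat \<Rightarrow> edge) set" where
  "X_max R = {p \<in> infinite_paths. \<forall>n. maximal_edge R (p n)}"

lemma incoming_interior:
  "incoming (Suc i, Suc j) = {((i, Suc j), (Suc i, Suc j)), ((Suc i, j), (Suc i, Suc j))}"
  by (auto simp: incoming_def pascal_edges_def)

lemma incoming_left: "incoming (0, Suc j) = {((0, j), (0, Suc j))}"
  by (auto simp: incoming_def pascal_edges_def)

lemma incoming_right: "incoming (Suc i, 0) = {((i, 0), (Suc i, 0))}"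
  by (auto simp: incoming_def pascal_edges_def)

end

theory Submission
  imports Defs "HOL-Analysis.Abstract_Topology_2" "HOL-Library.Countable"
begin

text \<open>
  A minimal path is a branch of the tree in which every vertex keeps only its minimal incoming
  edge, so a continuum of minimal paths requires that tree to have a continuum of branches.
  At the same time the maximal edges, which are the complementary ones, must carry an equally rich tree. The two demands
  do not interfere if the minimal paths are placed in the half \<open>i \<le> j\<close> of the diagram and the maximal
  ones, as their mirror images, in the half \<open>j \<le> i\<close>; the halves share only the vertices of the
  diagonal.

  The branches in the half \<open>i \<le> j\<close> can be indexed by the real numbers. Let \<open>d\<^sub>0, d\<^sub>1, \<dots>\<close> enumerate the
  rationals, possibly with repetitions, and let the path of a real \<open>x\<close> sit
  at levels \<open>2 m\<close> and \<open>2 m + 1\<close> in column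
  \<open>c\<^sub>m(x) = card {l < m. d\<^sub>l < x}\<close>, which is at most \<open>m\<close>. The points \<open>d\<^sub>0, \<dots>, d\<^sub>m\<^sub>-\<^sub>1\<close> cut the line into
  intervals, and the column is the number of the interval containing \<open>x\<close>. Passing from level
  \<open>2 m + 1\<close> to level \<open>2 m + 2\<close> adds the cut \<open>d\<^sub>m\<close>, which lies in the interval number \<open>s = c\<^sub>m(d\<^sub>m)\<close>:
  the intervals up to \<open>s\<close> keep their numbers, and the part of interval \<open>s\<close> above \<open>d\<^sub>m\<close> and all later
  intervals move up by one. Thus the column reached determines the edge by which a path arrives:
  the vertical one for columns \<open>\<le> s\<close>, the horizontal one for columns \<open>> s\<close>. Declaring these edges
  minimal makes all the paths minimal (\<open>minimal_edge_cut_path\<close>). The path of \<open>x\<close> remembers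
  which rationals lie below \<open>x\<close>, hence \<open>x\<close> itself (\<open>inj_cut_path\<close>).

  On the half \<open>j \<le> i\<close> the labels are chosen so that reflection in the diagonal exchanges minimal and
  maximal edges (\<open>maximal_edge_reflect\<close>); at diagonal vertices the two prescriptions agree.
  The upper bound on the number of paths holds because a path is a sequence in a countable set.
\<close>

section \<open>Positions of reals among the rationals\<close>

definition cut :: "nat \<Rightarrow> real" where
  "cut n = real_of_rat (nat_to_rat_surj n)"

definition cut_pos :: "nat \<Rightarrow> real \<Rightarrow> nat" where
  "cut_pos m x = card {l. l < m \<and> cut l < x}"

lemma cut_pos_0 [simp]: "cut_pos 0 x = 0"
  by (simp add: cut_pos_def)

lemma cut_pos_Suc: "cut_pos (Suc m) x = (if cut m < x then Suc (cut_pos m x) else cut_pos m x)"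
proof (cases "cut m < x")
  case True
  then have "{l. l < Suc m \<and> cut l < x} = insert m {l. l < m \<and> cut l < x}"
    by (auto simp: less_Suc_eq)
  with True show ?thesis by (simp add: cut_pos_def)
next
  case False
  then have "{l. l < Suc m \<and> cut l < x} = {l. l < m \<and> cut l < x}"
    by (auto simp: less_Suc_eq)
  with False show ?thesis by (simp add: cut_pos_def)
qed

lemma cut_pos_le: "cut_pos m x \<le> m"
  by (induction m) (auto simp: cut_pos_Suc)

lemma cut_pos_mono: "x \<le> y \<Longrightarrow> cut_pos m x \<le> cut_pos m y"
  unfolding cut_pos_def by (rule card_mono) auto

text \<open>The position changes at a cut exactly for the reals above it, so the sequence of positions of
  \<open>x\<close> determines the set of rationals below \<open>x\<close>.\<close>

lemma cut_pos_inject: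
  assumes "\<And>m. cut_pos m x = cut_pos m y"
  shows "x = y"
proof -
  have same_cuts: "cut m < x \<longleftrightarrow> cut m < y" for m
    using assms[of m] assms[of "Suc m"] by (auto simp: cut_pos_Suc split: if_splits)
  have not_less: "\<not> u < v" if "\<And>m. cut m < u \<longleftrightarrow> cut m < v" for u v
  proof
    assume "u < v"
    then obtain q where q: "u < real_of_rat q" "real_of_rat q < v"
      using of_rat_dense by blast
    obtain m where "q = nat_to_rat_surj m"
      using surj_nat_to_rat_surj by (metis surjD)
    with q that[of m] show False by (simp add: cut_def)
  qed
  from not_less[of x y] not_less[of y x] same_cuts show ?thesis by fastforce
qed

section \<open>The ordering\<close>

text \<open>The symmetric expression \<open>min i j\<close> extends the choice made for \<open>i \<le> j\<close> to the other half. As the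
  predicate is symmetric and reflection exchanges vertical and horizontal edges, the mirror image of
  the minimal edge is the maximal one wherever two edges arrive. The index
  \<open>(i + j) div 2 - 1\<close> is the number of the cut added on the way to level \<open>i + j\<close>. At odd levels, where no cut is added, all columns of the half \<open>i \<le> j\<close> are kept.\<close>

definition vertical_is_min :: "nat \<Rightarrow> nat \<Rightarrow> bool" where
  "vertical_is_min i j \<longleftrightarrow>
     odd (i + j) \<or> min i j \<le> (let m = (i + j) div 2 - 1 in cut_pos m (cut m))"

fun min_source :: "vertex \<Rightarrow> vertex" where
  "min_source (i, j) = (if vertical_is_min i j then (i, j - 1) else (i - 1, j))"

text \<open>At a vertex on the border \<open>min_source\<close> need not be the source of the only incoming edge;
  the reflexive part of the order then makes that edge minimal and maximal.\<close>

definition cut_order :: "vertex \<Rightarrow> edge rel" where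
  "cut_order v = {(e, e'). e \<in> incoming v \<and> e' \<in> incoming v \<and> (e = e' \<or> fst e = min_source v)}"

lemma incoming_cases:
  assumes "e \<in> incoming (i, j)"
  obtains "0 < i" "e = ((i - 1, j), (i, j))" | "0 < j" "e = ((i, j - 1), (i, j))"
  using assms by (auto simp: incoming_def pascal_edges_def)

lemma vertical_is_min_commute: "vertical_is_min i j \<longleftrightarrow> vertical_is_min j i"
  by (simp add: vertical_is_min_def add.commute min.commute)

lemma edge_ordering_cut_order: "edge_ordering cut_order"
  unfolding edge_ordering_def
proof (intro allI impI)
  fix v :: vertex
  have eq: "e = e'" if "e \<in> incoming v" "e' \<in> incoming v" "fst e = fst e'" for e e'
    using that by (auto simp: incoming_def prod_eq_iff)
  have total: "fst e = min_source v \<or> fst e' = min_source v"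
    if "e \<in> incoming v" "e' \<in> incoming v" "e \<noteq> e'" for e e'
  proof (cases v)
    case (Pair i j)
    with that show ?thesis by (auto elim!: incoming_cases)
  qed
  show "linear_order_on (incoming v) (cut_order v)"
    unfolding linear_order_on_def partial_order_on_def preorder_on_def
  proof (intro conjI)
    show "cut_order v \<subseteq> incoming v \<times> incoming v" by (auto simp: cut_order_def)
    show "refl_on (incoming v) (cut_order v)" by (auto simp: refl_on_def cut_order_def)
    show "trans (cut_order v)" unfolding trans_def cut_order_def by auto
    show "antisym (cut_order v)"
      unfolding antisym_def cut_order_def using eq by fastforce
    show "total_on (incoming v) (cut_order v)"
      unfolding total_on_def cut_order_def using total by blast
  qed
qed

lemma minimal_edge_cut_order:
  "minimal_edge cut_order e \<longleftrightarrow>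
     e \<in> pascal_edges \<and> (\<forall>e' \<in> incoming (snd e). e = e' \<or> fst e = min_source (snd e))"
  by (auto simp: minimal_edge_def cut_order_def incoming_def)

lemma maximal_edge_cut_order:
  "maximal_edge cut_order e \<longleftrightarrow>
     e \<in> pascal_edges \<and> (\<forall>e' \<in> incoming (snd e). e' = e \<or> fst e' = min_source (snd e))"
  by (auto simp: maximal_edge_def cut_order_def incoming_def)

section \<open>A minimal path for every real number\<close>

definition cut_vertex :: "real \<Rightarrow> nat \<Rightarrow> vertex" where
  "cut_vertex x n = (cut_pos (n div 2) x, n - cut_pos (n div 2) x)"

definition cut_path :: "real \<Rightarrow> nat \<Rightarrow> edge" where
  "cut_path x n = (cut_vertex x n, cut_vertex x (Suc n))"

lemma cut_pos_half_le: "2 * cut_pos (n div 2) x \<le> n"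
  using cut_pos_le[of "n div 2" x] by linarith

lemma cut_path_in_edges: "cut_path x n \<in> pascal_edges"
proof (cases "even n")
  case True
  with cut_pos_half_le[of n x] show ?thesis
    by (auto simp: cut_path_def cut_vertex_def pascal_edges_def)
next
  case False
  then obtain m where "n = 2 * m + 1" by (elim oddE)
  with cut_pos_le[of m x] show ?thesis
    by (auto simp: cut_path_def cut_vertex_def pascal_edges_def cut_pos_Suc)
qed

lemma cut_path_infinite_path: "cut_path x \<in> infinite_paths"
proof -
  have "cut_vertex x n \<in> level n" for n
    using cut_pos_half_le[of n x] by (simp add: cut_vertex_def level_def)
  moreover have "cut_vertex x 0 = (0, 0)"
    by (simp add: cut_vertex_def)
  ultimately show ?thesis
    using cut_path_in_edges[of x] by (simp add: infinite_paths_def cut_path_def)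
qed

lemma cut_path_source: "fst (cut_path x n) = min_source (snd (cut_path x n))"
proof (cases "even n")
  case True
  with cut_pos_half_le[of n x] show ?thesis
    by (auto simp: cut_path_def cut_vertex_def vertical_is_min_def)
next
  case False
  then obtain m where n: "n = 2 * m + 1" by (elim oddE)
  note bound = cut_pos_le[of m x]
  show ?thesis
  proof (cases "cut m < x")
    case True
    then have "cut_pos m (cut m) \<le> cut_pos m x" by (intro cut_pos_mono) simp
    with True bound n show ?thesis
      by (simp add: cut_path_def cut_vertex_def vertical_is_min_def cut_pos_Suc)
  next
    case False
    then have "cut_pos m x \<le> cut_pos m (cut m)" by (intro cut_pos_mono) simp
    with False bound n show ?thesis
      by (simp add: cut_path_def cut_vertex_def vertical_is_min_def cut_pos_Suc)
  qed
qed

lemma minimal_edge_cut_path: "minimal_edge cut_order (cut_path x n)"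
  using cut_path_in_edges cut_path_source by (simp add: minimal_edge_cut_order)

lemma inj_cut_path: "inj cut_path"
proof (rule injI)
  fix x y assume eq: "cut_path x = cut_path y"
  have "cut_pos m x = cut_pos m y" for m
    using fun_cong[OF eq, of "2 * m"] by (simp add: cut_path_def cut_vertex_def)
  then show "x = y" by (rule cut_pos_inject)
qed

lemma real_lepoll_X_min: "(UNIV :: real set) \<lesssim> X_min cut_order"
  unfolding lepoll_def
  using inj_cut_path cut_path_infinite_path minimal_edge_cut_path by (auto simp: X_min_def)

section \<open>Reflection in the diagonal\<close>

abbreviation reflect :: "edge \<Rightarrow> edge" where
  "reflect \<equiv> map_prod prod.swap prod.swap"

lemma reflect_in_edges: "e \<in> pascal_edges \<Longrightarrow> reflect e \<in> pascal_edges"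
  by (auto simp: pascal_edges_def)

text \<open>At a vertex with two incoming edges, reflection turns the minimal edge, say the vertical one,
  into the horizontal one at a vertex where again the vertical edge is minimal. On the border the
  only incoming edge is both minimal and maximal.\<close>

lemma maximal_edge_reflect:
  assumes "minimal_edge cut_order e"
  shows "maximal_edge cut_order (reflect e)"
proof -
  obtain u i j where e: "e = (u, (i, j))" by (metis prod.exhaust)
  from assms have edge: "e \<in> pascal_edges"
    and source: "\<And>e'. e' \<in> incoming (i, j) \<Longrightarrow> e = e' \<or> u = min_source (i, j)"
    by (auto simp: minimal_edge_cut_order e)
  have "e' = reflect e \<or> fst e' = min_source (j, i)" if e': "e' \<in> incoming (j, i)" for e'
  proof (rule disjCI)
    assume other: "fst e' \<noteq> min_source (j, i)"
    have "reflect e' \<in> incoming (i, j)"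
      using e' reflect_in_edges by (auto simp: incoming_def)
    from source[OF this] show "e' = reflect e"
    proof
      assume "e = reflect e'"
      then show ?thesis by (cases e') auto
    next
      assume u: "u = min_source (i, j)"
      show ?thesis
      proof (cases "vertical_is_min i j")
        case True
        with other have "fst e' \<noteq> (j, i - 1)"
          using vertical_is_min_commute[of i j] by auto
        with e' have "e' = ((j - 1, i), (j, i))" by (metis incoming_cases fst_conv)
        with True u show ?thesis by (simp add: e)
      next
        case False
        with other have "fst e' \<noteq> (j - 1, i)"
          using vertical_is_min_commute[of i j] by auto
        with e' have "e' = ((j, i - 1), (j, i))" by (metis incoming_cases fst_conv)
        with False u show ?thesis by (simp add: e)
      qed
    qed
  qed
  with edge show ?thesis by (auto simp: maximal_edge_cut_order e dest: reflect_in_edges)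
qed

lemma reflect_infinite_path: "p \<in> infinite_paths \<Longrightarrow> reflect \<circ> p \<in> infinite_paths"
  by (auto simp: infinite_paths_def level_def reflect_in_edges case_prod_unfold add.commute)

lemma X_min_lepoll_X_max: "X_min cut_order \<lesssim> X_max cut_order"
  unfolding lepoll_def
proof (intro exI conjI)
  have "inj reflect" by (simp add: prod.inj_map)
  then show "inj_on (\<lambda>p. reflect \<circ> p) (X_min cut_order)"
    by (intro inj_onI ext) (metis comp_apply injD)
  show "(\<lambda>p. reflect \<circ> p) ` X_min cut_order \<subseteq> X_max cut_order"
    by (auto simp: X_min_def X_max_def simp del: map_prod_simp
        intro!: reflect_infinite_path maximal_edge_reflect)
qed

section \<open>The upper bound\<close>

text \<open>A sequence in a countable type is determined by the set of codes of the pairs forming its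
  graph.\<close>

lemma countable_sequences_lepoll_real:
  "(UNIV :: (nat \<Rightarrow> 'a::countable) set) \<lesssim> (UNIV :: real set)"
proof -
  let ?graph = "\<lambda>p. range (\<lambda>n :: nat. to_nat (n, p n :: 'a))"
  have "inj ?graph"
  proof (intro injI ext)
    fix p q :: "nat \<Rightarrow> 'a" and n
    assume "?graph p = ?graph q"
    then have "to_nat (n, p n) \<in> ?graph q" by blast
    then show "p n = q n" by auto
  qed
  then have "(UNIV :: (nat \<Rightarrow> 'a) set) \<lesssim> (UNIV :: nat set set)"
    by (auto simp: lepoll_def)
  then show ?thesis
    using nat_sets_eqpoll_reals by (rule lepoll_trans2)
qed

theorem theorem4p1:
  shows "\<exists>R. edge_ordering R \<and> X_min R \<approx> (UNIV :: real set) \<and> X_max R \<approx> (UNIV :: real set)"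
proof (intro exI conjI)
  have upper: "P \<lesssim> (UNIV :: real set)" for P :: "(nat \<Rightarrow> edge) set"
    using subset_imp_lepoll[OF subset_UNIV] countable_sequences_lepoll_real by (rule lepoll_trans)
  show "edge_ordering cut_order" by (rule edge_ordering_cut_order)
  show "X_min cut_order \<approx> (UNIV :: real set)"
    using upper real_lepoll_X_min by (rule lepoll_antisym)
  show "X_max cut_order \<approx> (UNIV :: real set)"
    using upper lepoll_trans[OF real_lepoll_X_min X_min_lepoll_X_max] by (rule lepoll_antisym)
qed

end
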